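(* For every constant deletion probability $p\in(0,1)$ there is a constant $C>0$ (depending only on $p$) such that the following holds. Let $n\ge 2$ and $d\ge 1$ be integers and let $\mathbf{x},\mathbf{y}\in\{0,1\}^n$ be two distinct strings within Hamming distance $d$ of each other. Then there is a mean-based algorithm that distinguishes between $\mathbf{x}$ and $\mathbf{y}$ with high probability using at most $n^{Cd}$ traces.
   Context: Strings are indexed from $0$: $\mathbf{x}=x_0x_1\cdots x_{n-1}$. The deletion probability $p\in(0,1)$ is a constant. A trace $\tilde{\mathbf{x}}$ of $\mathbf{x}$ is the random subsequence of $\mathbf{x}$ obtained by deleting each bit independently with probability $p$; it is padded by setting $\tilde x_j=0$ for all $j\ge|\tilde{\mathbf{x}}|$. A mean-based algorithm using $T$ traces for distinguishing $\mathbf{x}$ and $\mathbf{y}$ (which are known to the algorithm) receives $T$ independent traces $\tilde{\mathbf{x}}^{(1)},\dots,\tilde{\mathbf{x}}^{(T)}$ of an unknown source string in $\{\mathbf{x},\mathbf{y}\}$, and its output (either "$\mathbf{x}$" or "$\mathbf{y}$") depends only on the empirical means $\hat E_j=\frac1T\sum_{t=1}^T \tilde x^{(t)}_j$, $j=0,\dots,n-1$. It distinguishes with high probability if, whichever of $\mathbf{x},\mathbf{y}$ is the source, it outputs the source with probability at least $2/3$. The Hamming distance is the number of indices $i$ with $x_i\ne y_i$. *)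

theory Defs
  imports "HOL-Probability.Probability" "HOL-Probability.Product_PMF"
begin

text \<open>Strings over \<open>{0,1}\<close> are Boolean lists, with \<open>True\<close> for the bit 1.\<close>

definition hamming_dist :: "bool list \<Rightarrow> bool list \<Rightarrow> nat" where
  "hamming_dist x y = card {i. i < length x \<and> x ! i \<noteq> y ! i}"

text \<open>The random function \<open>K\<close> marks the retained positions: each position is retained
  independently with probability \<open>1 - p\<close>.\<close>

definition trace_pmf :: "real \<Rightarrow> bool list \<Rightarrow> bool list pmf" where
  "trace_pmf p x =
     map_pmf (\<lambda>K. nths x {i. K i}) (Pi_pmf {..<length x} False (\<lambda>_. bernoulli_pmf (1 - p)))"

text \<open>The \<open>T\<close> traces are \<open>w 0, \<dots>, w (T - 1)\<close>; the entries \<open>w t\<close> with \<open>t \<ge> T\<close>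
  are fixed to the empty list and carry no information.\<close>

definition traces_pmf :: "nat \<Rightarrow> real \<Rightarrow> bool list \<Rightarrow> (nat \<Rightarrow> bool list) pmf" where
  "traces_pmf T p x = Pi_pmf {..<T} [] (\<lambda>_. trace_pmf p x)"

definition padded_bit :: "bool list \<Rightarrow> nat \<Rightarrow> real" where
  "padded_bit u j = (if j < length u then of_bool (u ! j) else 0)"

definition empirical_mean :: "nat \<Rightarrow> (nat \<Rightarrow> bool list) \<Rightarrow> nat \<Rightarrow> real" where
  "empirical_mean T w j = (1 / real T) * (\<Sum>t<T. padded_bit (w t) j)"

definition empirical_means :: "nat \<Rightarrow> nat \<Rightarrow> (nat \<Rightarrow> bool list) \<Rightarrow> real list" where
  "empirical_means n T w = map (empirical_mean T w) [0..<n]"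

definition mean_based :: "nat \<Rightarrow> nat \<Rightarrow> ((nat \<Rightarrow> bool list) \<Rightarrow> bool list) \<Rightarrow> bool" where
  "mean_based n T alg \<longleftrightarrow> (\<exists>g. \<forall>w. alg w = g (empirical_means n T w))"

definition distinguishes_whp ::
  "real \<Rightarrow> nat \<Rightarrow> ((nat \<Rightarrow> bool list) \<Rightarrow> bool list) \<Rightarrow> bool list \<Rightarrow> bool list \<Rightarrow> bool" where
  "distinguishes_whp p T alg x y \<longleftrightarrow>
     (\<forall>w. alg w \<in> {x, y}) \<and>
     (\<forall>s\<in>{x, y}. measure_pmf.prob (traces_pmf T p s) {w. alg w = s} \<ge> 2 / 3)"

end

(*
  If x and y differ in at most d positions, some binomial moment
  sum_k (x_k - y_k) (k choose m) with m < d is a nonzero integer: otherwise sum_k (x_k - y_k) q(k) = 0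
  for every polynomial q of degree < d, and q can be chosen to vanish at all but one of the
  differing positions.  Deletion scales the m-th binomial moment by exactly (1 - p)^(m + 1) in
  expectation, so the expected traces differ by at least ((1 - p) / n)^d in some coordinate j.
  Thresholding the j-th empirical mean then works by Hoeffding's inequality.
*)
theory Submission
  imports Defs "HOL-Probability.Hoeffding"
begin

section \<open>Binomial moments of a string\<close>

text \<open>This is the Taylor coefficient of order \<open>m\<close> at \<open>z = 1\<close> of the
  generating polynomial of \<open>u\<close>. Unlike power moments, it obeys a two-term recursion
  when a bit is prepended.\<close>

definition binomial_moment :: "nat \<Rightarrow> bool list \<Rightarrow> real" where
  "binomial_moment m u = (\<Sum>j<length u. of_bool (u ! j) * real (j choose m))"

lemma binomial_moment_Nil [simp]: "binomial_moment m [] = 0"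
  by (simp add: binomial_moment_def)

lemma binomial_moment_Cons_0:
  "binomial_moment 0 (b # u) = of_bool b + binomial_moment 0 u"
  unfolding binomial_moment_def length_Cons
  by (subst sum.lessThan_Suc_shift) simp

text \<open>Pascal's rule: prepending shifts all old positions by one, and the new bit at position 0
  has weight \<open>0 choose Suc m = 0\<close>.\<close>

lemma binomial_moment_Cons_Suc:
  "binomial_moment (Suc m) (b # u) = binomial_moment (Suc m) u + binomial_moment m u"
  unfolding binomial_moment_def length_Cons
  by (subst sum.lessThan_Suc_shift) (simp add: algebra_simps sum.distrib)

lemma binomial_moment_in_Ints: "binomial_moment m u \<in> \<int>"
  unfolding binomial_moment_def by (intro Ints_sum Ints_mult) auto

text \<open>A summation range free of the random length of a trace lets expectation and sum be
  exchanged.\<close>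

lemma binomial_moment_padded:
  assumes "length u \<le> n"
  shows "binomial_moment m u = (\<Sum>j<n. padded_bit u j * real (j choose m))"
  unfolding binomial_moment_def using assms
  by (intro sum.mono_neutral_cong_left) (auto simp: padded_bit_def)

text \<open>The recurrence \<open>(k - r) (k choose m) = (m + 1) (k choose (m + 1)) + (m - r) (k choose m)\<close>
  trades a linear factor for one more binomial moment.\<close>

lemma binomial_moments_vanish_prod:
  fixes a :: "nat \<Rightarrow> real"
  assumes "\<And>m. m \<le> M \<Longrightarrow> (\<Sum>k\<in>S. a k * real (k choose m)) = 0"
    and "finite R" and "m + card R \<le> M"
  shows "(\<Sum>k\<in>S. a k * real (k choose m) * (\<Prod>r\<in>R. real k - real r)) = 0"
  using assms(2,3)
proof (induction R arbitrary: m rule: finite_induct)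
  case empty
  then show ?case using assms(1) by simp
next
  case (insert r R)
  have step: "real (k choose m) * (real k - real r) =
      real (Suc m) * real (k choose Suc m) + (real m - real r) * real (k choose m)" for k
  proof (cases "m \<le> k")
    case True
    have "Suc m * (k choose Suc m) = (k choose m) * (k - m)"
      by (metis binomial_absorb_comp binomial_absorption mult.commute)
    then have "real (Suc m) * real (k choose Suc m) = real (k choose m) * (real k - real m)"
      using True by (metis of_nat_diff of_nat_mult)
    then show ?thesis by (simp add: algebra_simps)
  qed (simp add: binomial_eq_0)
  have "(\<Sum>k\<in>S. a k * real (k choose m) * (\<Prod>r\<in>insert r R. real k - real r)) =
      (\<Sum>k\<in>S. real (Suc m) * (a k * real (k choose Suc m) * (\<Prod>r\<in>R. real k - real r)) +
        (real m - real r) * (a k * real (k choose m) * (\<Prod>r\<in>R. real k - real r)))"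
  proof (intro sum.cong refl)
    fix k
    have "a k * real (k choose m) * (\<Prod>r\<in>insert r R. real k - real r) =
        a k * (real (k choose m) * (real k - real r)) * (\<Prod>r\<in>R. real k - real r)"
      using insert.hyps by simp
    also have "\<dots> = real (Suc m) * (a k * real (k choose Suc m) * (\<Prod>r\<in>R. real k - real r)) +
        (real m - real r) * (a k * real (k choose m) * (\<Prod>r\<in>R. real k - real r))"
      unfolding step by (simp only: algebra_simps)
    finally show "a k * real (k choose m) * (\<Prod>r\<in>insert r R. real k - real r) = \<dots>" .
  qed
  \<comment> \<open>One sum raises \<open>m\<close> by one, the other keeps it. Removing
    \<open>r\<close> from the product pays for the increase, so both stay within the budget
    \<open>M\<close>.\<close>
  also have "\<dots> = 0"
    unfolding sum.distrib sum_distrib_left [symmetric]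
    using insert.IH[of "Suc m"] insert.IH[of m] insert.prems insert.hyps by simp
  finally show ?case .
qed

lemma exists_nonzero_binomial_moment:
  fixes a :: "nat \<Rightarrow> real"
  assumes "finite S" "S \<noteq> {}" "\<And>k. k \<in> S \<Longrightarrow> a k \<noteq> 0"
  shows "\<exists>m<card S. (\<Sum>k\<in>S. a k * real (k choose m)) \<noteq> 0"
proof (rule ccontr)
  assume "\<not> ?thesis"
  then have van: "(\<Sum>k\<in>S. a k * real (k choose m)) = 0" if "m \<le> card S - 1" for m
    using that assms by (metis One_nat_def Suc_pred card_gt_0_iff less_Suc_eq_le)
  obtain k where k: "k \<in> S" using assms by blast
  define R where "R = S - {k}"
  \<comment> \<open>Taking \<open>m = 0\<close> leaves the bare product, whose degree
    \<open>card S - 1\<close> exactly uses up the vanishing moments. It is zero on \<open>S\<close>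
    except at \<open>k\<close>.\<close>
  have "(\<Sum>i\<in>S. a i * real (i choose 0) * (\<Prod>r\<in>R. real i - real r)) = 0"
    by (rule binomial_moments_vanish_prod[OF van]) (use assms k in \<open>auto simp: R_def\<close>)
  also have "(\<Sum>i\<in>S. a i * real (i choose 0) * (\<Prod>r\<in>R. real i - real r)) =
      (\<Sum>i\<in>S. if i = k then a k * (\<Prod>r\<in>R. real k - real r) else 0)"
    using assms(1) by (intro sum.cong refl) (auto simp: R_def)
  also have "\<dots> = a k * (\<Prod>r\<in>R. real k - real r)"
    using assms(1) k by simp
  finally show False
    using assms k by (auto simp: R_def)
qed

text \<open>Integrality upgrades a nonzero difference to a gap of at least 1, whatever the length of
  the strings.\<close>

lemma binomial_moment_separates:
  assumes "length x = length y" "x \<noteq> y" "hamming_dist x y \<le> d"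
  shows "\<exists>m<d. \<bar>binomial_moment m x - binomial_moment m y\<bar> \<ge> 1"
proof -
  define S where "S = {i. i < length x \<and> x ! i \<noteq> y ! i}"
  define a :: "nat \<Rightarrow> real" where "a i = of_bool (x ! i) - of_bool (y ! i)" for i
  have "finite S" "S \<noteq> {}" "\<And>k. k \<in> S \<Longrightarrow> a k \<noteq> 0"
    using assms(1,2) nth_equalityI[of x y] by (auto simp: S_def a_def)
  then obtain m where m: "m < card S" "(\<Sum>k\<in>S. a k * real (k choose m)) \<noteq> 0"
    using exists_nonzero_binomial_moment by blast
  have "binomial_moment m x - binomial_moment m y = (\<Sum>k<length x. a k * real (k choose m))"
    by (simp add: binomial_moment_def a_def assms(1) algebra_simps sum_subtractf)
  also have "\<dots> = (\<Sum>k\<in>S. a k * real (k choose m))"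
    by (intro sum.mono_neutral_right) (auto simp: S_def a_def)
  finally have "binomial_moment m x - binomial_moment m y \<noteq> 0"
    using m by simp
  moreover have "binomial_moment m x - binomial_moment m y \<in> \<int>"
    by (intro Ints_diff binomial_moment_in_Ints)
  ultimately have "\<bar>binomial_moment m x - binomial_moment m y\<bar> \<ge> 1"
    by (intro Ints_nonzero_abs_ge1)
  moreover have "m < d"
    using m(1) assms(3) by (simp add: hamming_dist_def S_def)
  ultimately show ?thesis by blast
qed

section \<open>Expected traces\<close>

lemma trace_pmf_Nil: "trace_pmf p [] = return_pmf []"
  by (simp add: trace_pmf_def)

text \<open>Conditioning on the fate of the first bit gives the recursion that drives the inductions
  on the source string.\<close>

lemma trace_pmf_Cons:
  "trace_pmf p (b # x) =
     bernoulli_pmf (1 - p) \<bind> (\<lambda>k. map_pmf (\<lambda>u. if k then b # u else u) (trace_pmf p x))"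
proof -
  let ?B = "\<lambda>A. Pi_pmf A False (\<lambda>_::nat. bernoulli_pmf (1 - p))"
  \<comment> \<open>Reindexing by \<open>Suc\<close> identifies the retention pattern of the tail
    inside \<open>b # x\<close> with that of \<open>x\<close> alone.\<close>
  have shift: "?B {..<length x} = map_pmf (\<lambda>g. g \<circ> Suc) (?B (Suc ` {..<length x}))"
    by (rule Pi_pmf_bij_betw) (auto simp: bij_betw_def)
  have "trace_pmf p (b # x) =
      map_pmf (\<lambda>K. nths (b # x) {i. K i}) (?B (insert 0 (Suc ` {..<length x})))"
    unfolding trace_pmf_def length_Cons lessThan_Suc_eq_insert_0 ..
  also have "?B (insert 0 (Suc ` {..<length x})) =
      bernoulli_pmf (1 - p) \<bind> (\<lambda>k. map_pmf (\<lambda>f. f(0 := k)) (?B (Suc ` {..<length x})))"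
    by (subst Pi_pmf_insert') (auto simp: map_pmf_def)
  finally show ?thesis
    unfolding trace_pmf_def shift map_bind_pmf
    by (auto simp: pmf.map_comp o_def nths_Cons intro!: bind_pmf_cong map_pmf_cong)
qed

lemma length_trace_le: "u \<in> set_pmf (trace_pmf p x) \<Longrightarrow> length u \<le> length x"
proof (induction x arbitrary: u)
  case (Cons b x)
  then show ?case
    by (auto simp: trace_pmf_Cons split: if_splits) fastforce+
qed (simp add: trace_pmf_Nil)

lemma finite_set_trace_pmf: "finite (set_pmf (trace_pmf p x))"
  by (rule finite_subset[OF _ finite_lists_length_le[of UNIV "length x"]])
     (auto dest: length_trace_le)

lemma integrable_trace_pmf [simp]:
  fixes f :: "bool list \<Rightarrow> real"
  shows "integrable (measure_pmf (trace_pmf p x)) f"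
  by (intro integrable_measure_pmf_finite finite_set_trace_pmf)

lemma expectation_trace_Cons:
  fixes f :: "bool list \<Rightarrow> real"
  assumes "0 < p" "p < 1"
  shows "measure_pmf.expectation (trace_pmf p (b # x)) f =
    (1 - p) * measure_pmf.expectation (trace_pmf p x) (\<lambda>u. f (b # u)) +
    p * measure_pmf.expectation (trace_pmf p x) f"
  unfolding trace_pmf_Cons
  using assms
  by (subst pmf_expectation_bind[where A = UNIV])
     (auto simp: finite_set_trace_pmf UNIV_bool)

text \<open>Coefficientwise form of the generating function identity
  \<open>(\<Sum>j. E\<^sub>j z ^ j) = (1 - p) (\<Sum>k. x\<^sub>k (p + (1 - p) z) ^ k)\<close>, expanded around \<open>z = 1\<close>.\<close>

lemma expectation_binomial_moment:
  assumes "0 < p" "p < 1"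
  shows "measure_pmf.expectation (trace_pmf p x) (binomial_moment m) =
    (1 - p) ^ Suc m * binomial_moment m x"
proof (induction x arbitrary: m)
  case Nil
  then show ?case by (simp add: trace_pmf_Nil)
next
  case (Cons b x)
  show ?case
    by (cases m)
       (simp_all add: expectation_trace_Cons[OF assms] binomial_moment_Cons_0
         binomial_moment_Cons_Suc Cons.IH algebra_simps)
qed

definition mean_trace :: "real \<Rightarrow> bool list \<Rightarrow> nat \<Rightarrow> real" where
  "mean_trace p x j = measure_pmf.expectation (trace_pmf p x) (\<lambda>u. padded_bit u j)"

lemma mean_trace_moment:
  assumes "0 < p" "p < 1"
  shows "(\<Sum>j<length x. mean_trace p x j * real (j choose m)) = (1 - p) ^ Suc m * binomial_moment m x"
proof -
  have "(\<Sum>j<length x. mean_trace p x j * real (j choose m)) =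
      measure_pmf.expectation (trace_pmf p x)
        (\<lambda>u. \<Sum>j<length x. padded_bit u j * real (j choose m))"
    by (simp add: mean_trace_def)
  also have "\<dots> = measure_pmf.expectation (trace_pmf p x) (binomial_moment m)"
    \<comment> \<open>The padded formula is valid only for \<open>u\<close> no longer than
      \<open>x\<close>, hence the equality on the support only.\<close>
    by (intro integral_cong_AE)
       (auto simp: AE_measure_pmf_iff binomial_moment_padded[OF length_trace_le])
  finally show ?thesis
    using expectation_binomial_moment[OF assms] by simp
qed

text \<open>If all coordinates were closer, the gap in the moment of order \<open>m\<close> would be
  below \<open>n * n ^ (d - 1)\<close> times the threshold, that is, below
  \<open>(1 - p) ^ d\<close>. Deletion shrinks the original gap of 1 to no less than that.\<close>

lemma mean_trace_separates:
  assumes p: "0 < p" "p < 1"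
    and xy: "length x = n" "length y = n" "x \<noteq> y" "hamming_dist x y \<le> d"
  shows "\<exists>j<n. \<bar>mean_trace p x j - mean_trace p y j\<bar> \<ge> ((1 - p) / real n) ^ d"
proof (rule ccontr)
  assume "\<not> ?thesis"
  then have small: "\<bar>mean_trace p x j - mean_trace p y j\<bar> < ((1 - p) / real n) ^ d" if "j < n" for j
    using that by (auto simp: not_le)
  define D where "D j = mean_trace p x j - mean_trace p y j" for j
  obtain m where m: "m < d" "\<bar>binomial_moment m x - binomial_moment m y\<bar> \<ge> 1"
    using binomial_moment_separates[of x y d] xy by auto
  have n: "n > 0" using xy by (cases n) auto
  have "(1 - p) ^ d \<le> (1 - p) ^ Suc m"
    using m(1) p by (intro power_decreasing) auto
  also have "\<dots> \<le> (1 - p) ^ Suc m * \<bar>binomial_moment m x - binomial_moment m y\<bar>"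
    using mult_left_mono[OF m(2), of "(1 - p) ^ Suc m"] p by simp
  also have "\<dots> = \<bar>(1 - p) ^ Suc m * (binomial_moment m x - binomial_moment m y)\<bar>"
    using p by (simp add: abs_mult)
  also have "(1 - p) ^ Suc m * (binomial_moment m x - binomial_moment m y) =
      (\<Sum>j<n. D j * real (j choose m))"
    using mean_trace_moment[OF p, of x m] mean_trace_moment[OF p, of y m] xy
    by (simp add: D_def right_diff_distrib left_diff_distrib sum_subtractf)
  also have "\<bar>\<dots>\<bar> \<le> (\<Sum>j<n. \<bar>D j\<bar> * real (j choose m))"
    by (rule order_trans[OF sum_abs]) (simp add: abs_mult)
  also have "\<dots> \<le> (\<Sum>j<n. \<bar>D j\<bar> * real n ^ (d - 1))"
  proof (intro sum_mono mult_left_mono)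
    fix j assume j: "j \<in> {..<n}"
    have "j choose m \<le> j ^ m"
      by (cases "m \<le> j") (auto simp: binomial_le_pow binomial_eq_0)
    also have "\<dots> \<le> n ^ m" using j by (intro power_mono) auto
    \<comment> \<open>Only \<open>m < d\<close> is known, so the weight is bounded uniformly in
      \<open>m\<close>.\<close>
    also have "\<dots> \<le> n ^ (d - 1)" using n m(1) by (intro power_increasing) auto
    finally show "real (j choose m) \<le> real n ^ (d - 1)"
      by (metis of_nat_le_iff of_nat_power)
  qed simp
  also have "\<dots> < (\<Sum>j<n. ((1 - p) / real n) ^ d * real n ^ (d - 1))"
    using n small by (intro sum_strict_mono mult_strict_right_mono) (auto simp: D_def)
  also have "\<dots> = (1 - p) ^ d * (real n * real n ^ (d - 1) / real n ^ d)"
    by (simp add: power_divide)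
  also have "real n * real n ^ (d - 1) = real n ^ d"
    using m(1) by (cases d) auto
  finally show False using n by simp
qed

section \<open>The threshold test\<close>

text \<open>Hoeffding's inequality for the sum of \<open>T\<close> independent variables in the unit
  interval, at deviation \<open>T * \<epsilon>\<close> and with total squared range
  \<open>T\<close>.\<close>

lemma empirical_mean_concentration:
  assumes "T > 0" "\<epsilon> \<ge> 0"
  shows "measure_pmf.prob (traces_pmf T p x) {w. \<bar>empirical_mean T w j - mean_trace p x j\<bar> \<ge> \<epsilon>}
    \<le> 2 * exp (-2 * real T * \<epsilon>\<^sup>2)"
proof -
  define X where "X t w = padded_bit (w t) j" for t and w :: "nat \<Rightarrow> bool list"
  have EX: "measure_pmf.expectation (traces_pmf T p x) (X t) = mean_trace p x j" if "t < T" for t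
  proof -
    have "trace_pmf p x = map_pmf (\<lambda>w. w t) (traces_pmf T p x)"
      unfolding traces_pmf_def by (subst Pi_pmf_component) (use that in auto)
    then show ?thesis
      by (simp add: mean_trace_def X_def [abs_def])
  qed
  interpret Hoeffding_ineq "measure_pmf (traces_pmf T p x)" "{..<T}" X "\<lambda>_. 0" "\<lambda>_. 1"
    "\<Sum>t<T. measure_pmf.expectation (traces_pmf T p x) (X t)"
  proof unfold_locales
    show "prob_space.indep_vars (measure_pmf (traces_pmf T p x)) (\<lambda>_. borel) X {..<T}"
      unfolding traces_pmf_def X_def
      by (rule prob_space.indep_vars_compose2[OF measure_pmf.prob_space_axioms
            indep_vars_Pi_pmf]) auto
  qed (auto simp: X_def padded_bit_def)
  have "{w. \<bar>empirical_mean T w j - mean_trace p x j\<bar> \<ge> \<epsilon>} =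
      {w. \<bar>(\<Sum>t<T. X t w) - (\<Sum>t<T. measure_pmf.expectation (traces_pmf T p x) (X t))\<bar> \<ge> real T * \<epsilon>}"
  proof (intro Collect_cong)
    fix w
    have "(\<Sum>t<T. X t w) - (\<Sum>t<T. measure_pmf.expectation (traces_pmf T p x) (X t)) =
        real T * (empirical_mean T w j - mean_trace p x j)"
      using assms EX by (simp add: empirical_mean_def X_def right_diff_distrib)
    then show "(\<epsilon> \<le> \<bar>empirical_mean T w j - mean_trace p x j\<bar>) \<longleftrightarrow>
        (real T * \<epsilon> \<le>
          \<bar>(\<Sum>t<T. X t w) - (\<Sum>t<T. measure_pmf.expectation (traces_pmf T p x) (X t))\<bar>)"
      using assms by (simp add: abs_mult)
  qed
  moreover have "-2 * (real T * \<epsilon>)\<^sup>2 / real T = -2 * real T * \<epsilon>\<^sup>2"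
    using assms by (simp add: power2_eq_square)
  ultimately show ?thesis
    using Hoeffding_ineq_abs_ge[of "real T * \<epsilon>"] assms by simp
qed

text \<open>The test asks whether coordinate \<open>j\<close> is within
  \<open>\<epsilon> / 2\<close> of its mean under \<open>x\<close>. With
  \<open>4 / \<epsilon>\<^sup>2\<close> traces the Hoeffding bound is at most
  \<open>2 * exp (-2)\<close>, which is below \<open>1 / 3\<close>.\<close>

lemma threshold_test_distinguishes:
  assumes "j < n" "\<epsilon> > 0" "\<bar>mean_trace p x j - mean_trace p y j\<bar> \<ge> \<epsilon>" "real T \<ge> 4 / \<epsilon>\<^sup>2"
  shows "\<exists>alg. mean_based n T alg \<and> distinguishes_whp p T alg x y"
proof -
  have "4 / \<epsilon>\<^sup>2 > 0" using assms(2) by simp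
  then have T: "T > 0" using assms(4) by (cases T) auto
  define alg where
    "alg w = (if \<bar>empirical_mean T w j - mean_trace p x j\<bar> < \<epsilon> / 2 then x else y)" for w
  have "mean_based n T alg"
    unfolding mean_based_def
    by (rule exI[of _ "\<lambda>l. if \<bar>l ! j - mean_trace p x j\<bar> < \<epsilon> / 2 then x else y"])
       (use assms(1) in \<open>simp add: alg_def empirical_means_def\<close>)
  moreover have "measure_pmf.prob (traces_pmf T p s) {w. alg w = s} \<ge> 2 / 3" if s: "s \<in> {x, y}" for s
  proof -
    let ?bad = "{w. \<bar>empirical_mean T w j - mean_trace p s j\<bar> \<ge> \<epsilon> / 2}"
    \<comment> \<open>Truncating the exponential series gives \<open>exp 1 \<ge> 5 / 2\<close>, and
      \<open>25 / 4\<close> exceeds 6.\<close>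
    have "(6::real) \<le> exp 1 * exp 1"
      using mult_mono[of "5/2::real" "exp 1" "5/2" "exp 1"] exp_lower_Taylor_quadratic[of "1::real"]
      by simp
    then have e2: "(6::real) \<le> exp 2"
      by (simp add: exp_add[symmetric])
    have "4 \<le> real T * \<epsilon>\<^sup>2"
      using assms(2,4) by (simp add: field_simps)
    then have "2 * exp (-2 * real T * (\<epsilon> / 2)\<^sup>2) \<le> 2 * exp (-2)"
      by (simp add: power_divide)
    also have "\<dots> \<le> 1 / 3"
      using e2 by (simp add: exp_minus field_simps)
    finally have "measure_pmf.prob (traces_pmf T p s) ?bad \<le> 1 / 3"
      using empirical_mean_concentration[OF T, of "\<epsilon> / 2" p s j] assms(2) by linarith
    then have "2 / 3 \<le> measure_pmf.prob (traces_pmf T p s) (- ?bad)"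
      by (simp add: measure_pmf.prob_compl[of ?bad, simplified, folded Compl_eq_Diff_UNIV])
    also have "\<dots> \<le> measure_pmf.prob (traces_pmf T p s) {w. alg w = s}"
    proof (intro measure_pmf.finite_measure_mono subsetI)
      fix w
      assume "w \<in> - ?bad"
      then have "\<bar>empirical_mean T w j - mean_trace p s j\<bar> < \<epsilon> / 2"
        by simp
      \<comment> \<open>By the triangle inequality, a value within \<open>\<epsilon> / 2\<close> of
        one mean is at least \<open>\<epsilon> / 2\<close> away from the other.\<close>
      moreover from this have "\<not> \<bar>empirical_mean T w j - mean_trace p x j\<bar> < \<epsilon> / 2" if "s = y"
        using assms(3) unfolding that by linarith
      ultimately have "alg w = s"
        using s by (auto simp: alg_def)
      then show "w \<in> {w. alg w = s}" by simp
    qed simp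
    finally show ?thesis .
  qed
  ultimately show ?thesis
    unfolding distinguishes_whp_def by (intro exI[of _ alg]) (auto simp: alg_def)
qed

section \<open>Number of traces and conclusion\<close>

lemma sample_size_bound:
  fixes p :: real
  assumes p: "0 < p" "p < 1" and "n \<ge> 2" "d \<ge> 1"
  defines "\<epsilon> \<equiv> ((1 - p) / real n) ^ d"
  shows "real (nat \<lceil>4 / \<epsilon>\<^sup>2\<rceil>) \<le> real n powr ((5 + 2 * log 2 (1 / (1 - p))) * real d)"
proof -
  define L where "L = log 2 (1 / (1 - p))"
  have L: "L \<ge> 0" using p by (simp add: L_def)
  have \<epsilon>: "0 < \<epsilon>" "\<epsilon> \<le> 1"
    using assms(3) p by (auto simp: \<epsilon>_def intro!: power_le_one)
  have "real (nat \<lceil>4 / \<epsilon>\<^sup>2\<rceil>) \<le> 4 / \<epsilon>\<^sup>2 + 1"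
    using \<epsilon> by simp
  \<comment> \<open>The loss from rounding up is absorbed by doubling, which produces the factor
    \<open>2 ^ 3\<close>.\<close>
  also have "1 \<le> 4 / \<epsilon>\<^sup>2"
    using \<epsilon> power_le_one[of \<epsilon> 2] by (simp add: field_simps)
  also have "4 / \<epsilon>\<^sup>2 + 4 / \<epsilon>\<^sup>2 = 2 ^ 3 * (1 / \<epsilon>)\<^sup>2"
    by (simp add: power_divide)
  also have "\<dots> \<le> real n powr 3 * (real n powr ((1 + L) * real d))\<^sup>2"
  proof (intro mult_mono power_mono)
    have "1 / (1 - p) = 2 powr L"
      using p by (simp add: L_def)
    \<comment> \<open>Since \<open>n \<ge> 2\<close>, any constant \<open>2 powr L\<close> with
      \<open>L \<ge> 0\<close> is at most a fixed power of \<open>n\<close>.\<close>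
    also have "\<dots> \<le> real n powr L"
      using L assms(3) by (intro powr_mono2) auto
    finally have "real n * (1 / (1 - p)) \<le> real n * real n powr L"
      by (intro mult_left_mono) auto
    also have "\<dots> = real n powr (1 + L)"
      using assms(3) by (simp add: powr_add)
    finally have "(real n * (1 / (1 - p))) ^ d \<le> (real n powr (1 + L)) ^ d"
      using p by (intro power_mono) auto
    also have "\<dots> = real n powr ((1 + L) * real d)"
      using assms(3) by (simp add: powr_powr flip: powr_realpow)
    finally show "1 / \<epsilon> \<le> real n powr ((1 + L) * real d)"
      by (simp add: \<epsilon>_def power_divide power_mult_distrib)
    have "(2::real) ^ 3 \<le> real n ^ 3" using assms(3) by (intro power_mono) auto
    then show "2 ^ 3 \<le> real n powr 3" using assms(3) by simp
  qed (use \<epsilon> in auto)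
  also have "\<dots> = real n powr (3 + 2 * ((1 + L) * real d))"
    using assms(3) by (simp only: powr_add mult_2 power2_eq_square)
  \<comment> \<open>Here \<open>d \<ge> 1\<close> turns the additive 3 into \<open>3 * d\<close>,
    whence \<open>5 = 3 + 2\<close>.\<close>
  also have "\<dots> \<le> real n powr ((5 + 2 * L) * real d)"
    using assms(3,4) by (intro powr_mono) (auto simp: algebra_simps)
  finally show ?thesis by (simp add: L_def)
qed

theorem theorem1:
  fixes p :: real
  assumes "0 < p" and "p < 1"
  shows "\<exists>C::real. C > 0 \<and>
    (\<forall>(n::nat) (d::nat) (x::bool list) (y::bool list).
       n \<ge> 2 \<longrightarrow> d \<ge> 1 \<longrightarrow> length x = n \<longrightarrow> length y = n \<longrightarrow> x \<noteq> y \<longrightarrow> hamming_dist x y \<le> d \<longrightarrow>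
       (\<exists>(T::nat) alg. T \<ge> 1 \<and> real T \<le> real n powr (C * real d) \<and>
          mean_based n T alg \<and> distinguishes_whp p T alg x y))"
proof (rule exI[of _ "5 + 2 * log 2 (1 / (1 - p))"], rule conjI)
  have "log 2 (1 / (1 - p)) \<ge> 0"
    using assms by simp
  then show "5 + 2 * log 2 (1 / (1 - p)) > 0" by linarith
next
  have main: "\<exists>(T::nat) alg. T \<ge> 1 \<and>
      real T \<le> real n powr ((5 + 2 * log 2 (1 / (1 - p))) * real d) \<and>
      mean_based n T alg \<and> distinguishes_whp p T alg x y"
    if *: "n \<ge> 2" "d \<ge> 1" "length x = n" "length y = n" "x \<noteq> y" "hamming_dist x y \<le> d"
    for n d :: nat and x y :: "bool list"
  proof -
    define \<epsilon> where "\<epsilon> = ((1 - p) / real n) ^ d"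
    define T where "T = nat \<lceil>4 / \<epsilon>\<^sup>2\<rceil>"
    have \<epsilon>: "\<epsilon> > 0" using * assms by (simp add: \<epsilon>_def)
    obtain j where j: "j < n" "\<bar>mean_trace p x j - mean_trace p y j\<bar> \<ge> \<epsilon>"
      using mean_trace_separates[OF assms *(3-6)] by (auto simp: \<epsilon>_def)
    \<comment> \<open>Positivity makes \<open>nat\<close> harmless on the ceiling and forces at
      least one trace.\<close>
    have "0 < 4 / \<epsilon>\<^sup>2" using \<epsilon> by simp
    then have "T \<ge> 1" "real T \<ge> 4 / \<epsilon>\<^sup>2"
      unfolding T_def by linarith+
    moreover have "real T \<le> real n powr ((5 + 2 * log 2 (1 / (1 - p))) * real d)"
      using sample_size_bound[OF assms *(1,2)] by (simp add: T_def \<epsilon>_def)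
    ultimately show ?thesis
      using threshold_test_distinguishes[OF j(1) \<epsilon> j(2)] by blast
  qed
  show "\<forall>n d x y. n \<ge> 2 \<longrightarrow> d \<ge> 1 \<longrightarrow> length x = n \<longrightarrow> length y = n \<longrightarrow> x \<noteq> y \<longrightarrow>
      hamming_dist x y \<le> d \<longrightarrow> (\<exists>T alg. T \<ge> 1 \<and>
        real T \<le> real n powr ((5 + 2 * log 2 (1 / (1 - p))) * real d) \<and>
        mean_based n T alg \<and> distinguishes_whp p T alg x y)"
    by (intro allI impI) (rule main)
qed

end
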